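(* Let $A$ and $B$ be square-free monomials in the variables $a_{ij}$ (i.e. simple graphs on $\{1,\dots,n\}$). Then in $R_n$, $$I(A)\,I(B)=\sum_{g\in[\mathrm{Stab}(A):S_n:\mathrm{Stab}(B)]}\frac{|\mathrm{Stab}(\widehat{A\,g(B)})|}{|\mathrm{Stab}(A)\cap g\,\mathrm{Stab}(B)\,g^{-1}|}\,I(\widehat{A\,g(B)}).$$
   Context: Fix $n\ge 1$. Let $a_{ij}$, $1\le i<j\le n$, be variables with the convention $a_{ji}=a_{ij}$, and let $R_n=\mathbb{C}[a_{ij}]/\langle a_{ij}^2-a_{ij}\rangle$. The symmetric group $S_n$ acts on monomials by $\rho(a_{ij})=a_{\rho(i)\rho(j)}$. For a monomial $M$ in the polynomial ring $\mathbb{C}[a_{ij}]$, $\mathrm{Stab}(M)=\{\rho\in S_n:\rho(M)=M\}$, and $I(M)=\sum_{\rho\in S_n/\mathrm{Stab}(M)}\rho(M)$ (the sum of the distinct monomials in the orbit of $M$), viewed in $R_n$. For a monomial $M=\prod a_{i_kj_k}^{e_k}$ with $e_k\ge1$, $\widehat{M}=\prod a_{i_kj_k}$ is the square-free monomial with the same variables. For subgroups $H,K\le S_n$, $[H:S_n:K]$ denotes a set of representatives of the double cosets $HgK$, so that $S_n$ is the disjoint union of $HgK$ over $g\in[H:S_n:K]$. $A\,g(B)$ is the product in $\mathbb{C}[a_{ij}]$ of $A$ and $g(B)$. *)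

theory Defs
  imports
    Complex_Main
    "HOL-Library.Poly_Mapping"
    "HOL-Library.Disjoint_Sets"
    "HOL-Algebra.Sym_Groups"
    "HOL-Algebra.Group_Action"
    "HOL-Algebra.QuotRing"
begin

text \<open>The variable \<open>a_ij\<close> is the unordered pair \<open>{i, j}\<close>, so that \<open>a_ij = a_ji\<close> holds by
  construction. A monomial is its exponent vector, hence the product of monomials is \<open>+\<close> and
  the monomial \<open>1\<close> is \<open>0\<close>. A polynomial is a finitely supported map from monomials to
  coefficients; its product is convolution.\<close>

type_synonym monomial = "nat set \<Rightarrow>\<^sub>0 nat"
type_synonym polynomial = "monomial \<Rightarrow>\<^sub>0 complex"

definition edges :: "nat \<Rightarrow> nat set set" where
  "edges n = {{i, j} | i j. 1 \<le> i \<and> i < j \<and> j \<le> n}"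

definition monomials :: "nat \<Rightarrow> monomial set" where
  "monomials n = {M. Poly_Mapping.keys M \<subseteq> edges n}"

definition square_free :: "monomial \<Rightarrow> bool" where
  "square_free M \<longleftrightarrow> (\<forall>e. Poly_Mapping.lookup M e \<le> 1)"

definition sqfree_part :: "monomial \<Rightarrow> monomial" where
  "sqfree_part M = (\<Sum>e\<in>Poly_Mapping.keys M. Poly_Mapping.single e 1)"

text \<open>\<open>\<rho>(a_ij) = a_(\<rho> i)(\<rho> j)\<close>, extended multiplicatively to monomials.\<close>

definition act :: "(nat \<Rightarrow> nat) \<Rightarrow> monomial \<Rightarrow> monomial" where
  "act \<rho> M = (\<Sum>e\<in>Poly_Mapping.keys M. Poly_Mapping.single (\<rho> ` e) (Poly_Mapping.lookup M e))"

definition Stab :: "nat \<Rightarrow> monomial \<Rightarrow> (nat \<Rightarrow> nat) set" where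
  "Stab n M = stabilizer (sym_group n) act M"

definition poly_ring :: "nat \<Rightarrow> polynomial ring" where
  "poly_ring n =
    \<lparr>carrier = {p. Poly_Mapping.keys p \<subseteq> monomials n}, mult = (*), one = 1, zero = 0, add = (+)\<rparr>"

definition idem_ideal :: "nat \<Rightarrow> polynomial set" where
  "idem_ideal n = Idl\<^bsub>poly_ring n\<^esub>
    {Poly_Mapping.single (Poly_Mapping.single e 2) 1
      - Poly_Mapping.single (Poly_Mapping.single e 1) 1 | e. e \<in> edges n}"

definition Rring :: "nat \<Rightarrow> polynomial set ring" where
  "Rring n = poly_ring n Quot idem_ideal n"

definition to_R :: "nat \<Rightarrow> polynomial \<Rightarrow> polynomial set" where
  "to_R n p = idem_ideal n +>\<^bsub>poly_ring n\<^esub> p"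

definition scalar :: "nat \<Rightarrow> complex \<Rightarrow> polynomial set" where
  "scalar n c = to_R n (Poly_Mapping.single 0 c)"

text \<open>The sum of \<open>\<rho>(M)\<close> over \<open>\<rho> \<in> S_n / Stab(M)\<close>, i.e. of the distinct monomials in the orbit.\<close>

definition Iorb :: "nat \<Rightarrow> monomial \<Rightarrow> polynomial set" where
  "Iorb n M = to_R n (\<Sum>N\<in>orbit (sym_group n) act M. Poly_Mapping.single N 1)"

definition double_coset :: "('a, 'b) monoid_scheme \<Rightarrow> 'a set \<Rightarrow> 'a \<Rightarrow> 'a set \<Rightarrow> 'a set" where
  "double_coset G H g K = (H #>\<^bsub>G\<^esub> g) <#>\<^bsub>G\<^esub> K"

definition double_coset_reps :: "('a, 'b) monoid_scheme \<Rightarrow> 'a set \<Rightarrow> 'a set \<Rightarrow> 'a set \<Rightarrow> bool" where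
  "double_coset_reps G H K T \<longleftrightarrow>
    T \<subseteq> carrier G \<and>
    (\<Union>g\<in>T. double_coset G H g K) = carrier G \<and>
    disjoint_family_on (\<lambda>g. double_coset G H g K) T"

definition conj_set :: "('a, 'b) monoid_scheme \<Rightarrow> 'a \<Rightarrow> 'a set \<Rightarrow> 'a set" where
  "conj_set G g K = (g <#\<^bsub>G\<^esub> K) #>\<^bsub>G\<^esub> (inv\<^bsub>G\<^esub> g)"

end

theory Submission
  imports Defs
begin

text \<open>Up to the factor \<open>|Stab(A)| |Stab(B)|\<close>, the product \<open>I(A) I(B)\<close> is the sum of \<open>\<rho>(A) \<sigma>(B)\<close> over all
  \<open>\<rho>, \<sigma> \<in> S_n\<close>. With \<open>\<sigma> = \<rho> h\<close> this becomes the sum over \<open>h\<close> of the full symmetrizations of \<open>A h(B)\<close>,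
  which depend only on the double coset of \<open>h\<close>. The double coset of \<open>g\<close> has
  \<open>|Stab(A)| |Stab(B)| / |Stab(A) \<inter> g Stab(B) g\<^sup>-\<^sup>1|\<close> elements, and modulo the relations a monomial
  may be replaced by its square-free part before its symmetrization is turned back into an orbit sum.\<close>

section \<open>Sums over orbits and double cosets by counting fibres\<close>

lemma sum_constant_fibres:
  fixes F :: "'b \<Rightarrow> 'r::semiring_1"
  assumes "finite X" and "\<And>x. x \<in> X \<Longrightarrow> card {z \<in> X. f z = f x} = c"
  shows "(\<Sum>x\<in>X. F (f x)) = of_nat c * (\<Sum>y\<in>f ` X. F y)"
proof -
  have "(\<Sum>x\<in>X. F (f x)) = (\<Sum>y\<in>f ` X. \<Sum>x | x \<in> X \<and> f x = y. F (f x))"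
    using assms(1) by (rule sum.image_gen)
  also have "\<dots> = (\<Sum>y\<in>f ` X. of_nat c * F y)"
  proof (rule sum.cong)
    fix y assume "y \<in> f ` X"
    then have "card {x. x \<in> X \<and> f x = y} = c"
      using assms(2) by auto
    moreover have "(\<Sum>x | x \<in> X \<and> f x = y. F (f x)) = (\<Sum>x | x \<in> X \<and> f x = y. F y)"
      by (rule sum.cong) auto
    ultimately show "(\<Sum>x | x \<in> X \<and> f x = y. F (f x)) = of_nat c * F y"
      by simp
  qed simp
  finally show ?thesis
    by (simp add: sum_distrib_left)
qed

text \<open>The fibre of the orbit map \<open>\<phi> _ x\<close> through \<open>h\<close> is the
  left coset of the stabilizer of \<open>x\<close> containing \<open>h\<close>, so all fibres have
  the size of that stabilizer.\<close>

lemma (in group_action) sum_over_group: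
  fixes F :: "'c \<Rightarrow> 'r::semiring_1"
  assumes "finite (carrier G)" and x: "x \<in> E"
  shows "(\<Sum>g\<in>carrier G. F (\<phi> g x)) =
    of_nat (card (stabilizer G \<phi> x)) * (\<Sum>y\<in>orbit G \<phi> x. F y)"
proof -
  interpret group G
    using group_hom group_hom.axioms(1) by auto
  have "card {g \<in> carrier G. \<phi> g x = \<phi> h x} = card (stabilizer G \<phi> x)"
    if h: "h \<in> carrier G" for h
  proof -
    have "bij_betw (\<lambda>s. h \<otimes> s) (stabilizer G \<phi> x) {g \<in> carrier G. \<phi> g x = \<phi> h x}"
    proof (rule bij_betw_byWitness[where f' = "\<lambda>g. inv h \<otimes> g"])
      show "(\<lambda>g. inv h \<otimes> g) ` {g \<in> carrier G. \<phi> g x = \<phi> h x} \<subseteq> stabilizer G \<phi> x"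
        using h x by (auto simp: stabilizer_def composition_rule orbit_sym_aux)
    qed (use h x in \<open>auto simp: stabilizer_def composition_rule m_assoc[symmetric]\<close>)
    then show ?thesis
      by (simp add: bij_betw_same_card)
  qed
  from sum_constant_fibres[OF assms(1) this, of F] show ?thesis
    by (simp add: orbit_def setcompr_eq_image)
qed

lemma (in group) mem_conj_set:
  assumes "K \<subseteq> carrier G" "g \<in> carrier G"
  shows "z \<in> conj_set G g K \<longleftrightarrow> z \<in> carrier G \<and> inv g \<otimes> z \<otimes> g \<in> K"
proof
  assume "z \<in> conj_set G g K"
  then obtain k where k: "k \<in> K" "z = g \<otimes> k \<otimes> inv g"
    by (auto simp: conj_set_def l_coset_def r_coset_def)
  moreover have "k \<in> carrier G"
    using k assms by auto
  ultimately show "z \<in> carrier G \<and> inv g \<otimes> z \<otimes> g \<in> K"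
    using assms by (auto simp: m_assoc[symmetric]) (auto simp: m_assoc)
next
  assume z: "z \<in> carrier G \<and> inv g \<otimes> z \<otimes> g \<in> K"
  have "z = g \<otimes> (inv g \<otimes> z \<otimes> g) \<otimes> inv g"
    using z assms by (simp add: m_assoc[symmetric]) (simp add: m_assoc)
  with z show "z \<in> conj_set G g K"
    unfolding conj_set_def l_coset_def r_coset_def by blast
qed

lemma (in group) double_coset_eq_image:
  "double_coset G H g K = (\<lambda>(x, y). x \<otimes> g \<otimes> y) ` (H \<times> K)"
  unfolding double_coset_def r_coset_def set_mult_def by (auto simp: image_iff)

text \<open>In the fibre of \<open>(x, y)\<close> to \<open>x g y\<close> through
  \<open>(a, b)\<close>, write \<open>x = a z\<close> with \<open>z\<close> in \<open>H\<close>.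
  Then \<open>y\<close> must be the inverse of \<open>g\<^sup>-\<^sup>1 z g\<close> times
  \<open>b\<close>, and this lies in \<open>K\<close> exactly when \<open>z\<close> lies in the
  conjugate of \<open>K\<close> by \<open>g\<close>. With \<open>F = 1\<close> this is the formula
  for the size of a double coset.\<close>

lemma (in group) sum_over_double_coset:
  fixes F :: "'a \<Rightarrow> 'r::semiring_1"
  assumes fin: "finite (carrier G)" and H: "subgroup H G" and K: "subgroup K G"
    and g: "g \<in> carrier G"
  shows "(\<Sum>(x, y)\<in>H \<times> K. F (x \<otimes> g \<otimes> y)) =
    of_nat (card (H \<inter> conj_set G g K)) * (\<Sum>h\<in>double_coset G H g K. F h)"
proof -
  interpret H: subgroup H G by fact
  interpret K: subgroup K G by fact
  let ?f = "\<lambda>(x, y). x \<otimes> g \<otimes> y"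
  have finHK: "finite (H \<times> K)"
    using finite_subset[OF H.subset fin] finite_subset[OF K.subset fin] by simp
  have "card {p \<in> H \<times> K. ?f p = ?f q} = card (H \<inter> conj_set G g K)"
    if "q \<in> H \<times> K" for q
  proof -
    obtain a b where q: "q = (a, b)" and ab: "a \<in> H" "b \<in> K"
      using \<open>q \<in> H \<times> K\<close> by auto
    have c: "a \<in> carrier G" "b \<in> carrier G"
      using ab by auto
    \<comment> \<open>In a pair of the fibre the first component determines the second, so the
      inverse of the parametrization may forget \<open>y\<close>.\<close>
    have y: "y = inv (inv g \<otimes> (inv a \<otimes> x) \<otimes> g) \<otimes> b"
      if "x \<in> carrier G" "y \<in> carrier G" "x \<otimes> g \<otimes> y = a \<otimes> g \<otimes> b" for x y
    proof -
      have "y = inv (x \<otimes> g) \<otimes> (a \<otimes> g \<otimes> b)"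
        using that g by (metis inv_solve_left m_closed)
      then show ?thesis
        using that c g by (simp add: inv_mult_group m_assoc)
    qed
    have "bij_betw (\<lambda>z. (a \<otimes> z, inv (inv g \<otimes> z \<otimes> g) \<otimes> b)) (H \<inter> conj_set G g K)
      {p \<in> H \<times> K. ?f p = ?f q}"
    proof (rule bij_betw_byWitness[where f' = "\<lambda>(x, y). inv a \<otimes> x"])
      show "\<forall>z\<in>H \<inter> conj_set G g K.
          (\<lambda>(x, y). inv a \<otimes> x) (a \<otimes> z, inv (inv g \<otimes> z \<otimes> g) \<otimes> b) = z"
        using c by (auto simp: m_assoc[symmetric])
      show "\<forall>p\<in>{p \<in> H \<times> K. ?f p = ?f q}.
          (\<lambda>z. (a \<otimes> z, inv (inv g \<otimes> z \<otimes> g) \<otimes> b)) ((\<lambda>(x, y). inv a \<otimes> x) p) = p"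
        using c by (auto simp: q y[symmetric] m_assoc[symmetric])
      show "(\<lambda>z. (a \<otimes> z, inv (inv g \<otimes> z \<otimes> g) \<otimes> b)) ` (H \<inter> conj_set G g K)
          \<subseteq> {p \<in> H \<times> K. ?f p = ?f q}"
      proof -
        \<comment> \<open>Once products are nested to the right, an element and its inverse meet
          only in this shape.\<close>
        have cancel: "u \<otimes> (inv u \<otimes> w) = w" if "u \<in> carrier G" "w \<in> carrier G" for u w
          using that by (simp add: m_assoc[symmetric])
        have "a \<otimes> z \<otimes> g \<otimes> (inv (inv g \<otimes> z \<otimes> g) \<otimes> b) = a \<otimes> g \<otimes> b" if "z \<in> carrier G" for z
          using that c g by (simp add: inv_mult_group m_assoc cancel)
        note cancel_conj = this
        show ?thesis
        proof (rule image_subsetI)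
          fix z assume "z \<in> H \<inter> conj_set G g K"
          then have z: "z \<in> H" "z \<in> carrier G" "inv g \<otimes> z \<otimes> g \<in> K"
            unfolding Int_iff mem_conj_set[OF K.subset g] by blast+
          have "a \<otimes> z \<in> H" "inv (inv g \<otimes> z \<otimes> g) \<otimes> b \<in> K"
            using ab z by (blast intro: H.m_closed K.m_closed K.m_inv_closed)+
          with cancel_conj[OF z(2)] show "(a \<otimes> z, inv (inv g \<otimes> z \<otimes> g) \<otimes> b) \<in> {p \<in> H \<times> K. ?f p = ?f q}"
            by (simp only: q mem_Collect_eq mem_Times_iff fst_conv snd_conv case_prod_conv simp_thms)
        qed
      qed
      show "(\<lambda>(x, y). inv a \<otimes> x) ` {p \<in> H \<times> K. ?f p = ?f q} \<subseteq> H \<inter> conj_set G g K"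
      proof -
        have "inv g \<otimes> (inv a \<otimes> x) \<otimes> g \<in> K"
          if xy: "x \<in> H" "y \<in> K" "x \<otimes> g \<otimes> y = a \<otimes> g \<otimes> b" for x y
        proof -
          have xc: "x \<in> carrier G" "y \<in> carrier G"
            using xy by auto
          \<comment> \<open>Solving \<open>x g y = a g b\<close> turns the conjugate, so far only
            known to lie in the group, into a product of elements of \<open>K\<close>.\<close>
          have "inv g \<otimes> (inv a \<otimes> x) \<otimes> g = b \<otimes> inv y"
          proof -
            have "x \<otimes> g = a \<otimes> g \<otimes> b \<otimes> inv y"
              using xy xc c g by (metis inv_solve_right m_closed)
            then have "inv (a \<otimes> g) \<otimes> (x \<otimes> g) = b \<otimes> inv y"
              using xc c g by (simp add: m_assoc inv_solve_left')
            then show ?thesis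
              using xc c g by (simp add: inv_mult_group m_assoc)
          qed
          then show ?thesis
            using xy ab by simp
        qed
        note in_K = this
        have "inv a \<otimes> x \<in> H \<inter> conj_set G g K"
          if "x \<in> H" "y \<in> K" "x \<otimes> g \<otimes> y = a \<otimes> g \<otimes> b" for x y
          unfolding Int_iff mem_conj_set[OF K.subset g]
          using in_K[OF that] that(1) ab(1) by simp
        then show ?thesis
          by (clarsimp simp only: q mem_Times_iff fst_conv snd_conv case_prod_conv)
      qed
    qed
    then show ?thesis
      by (simp add: bij_betw_same_card)
  qed
  from sum_constant_fibres[OF finHK this, of F] show ?thesis
    by (simp add: double_coset_eq_image case_prod_unfold)
qed

lemma (in group) sum_right_translate:
  assumes "s \<in> carrier G"
  shows "(\<Sum>x\<in>carrier G. F (x \<otimes> s)) = (\<Sum>x\<in>carrier G. F x)"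
  by (rule sum.reindex_bij_witness[where i = "\<lambda>x. x \<otimes> inv s" and j = "\<lambda>x. x \<otimes> s"])
    (use assms in \<open>auto simp: m_assoc\<close>)

lemma (in group) sum_left_translate:
  assumes "s \<in> carrier G"
  shows "(\<Sum>x\<in>carrier G. F (s \<otimes> x)) = (\<Sum>x\<in>carrier G. F x)"
  by (rule sum.reindex_bij_witness[where i = "\<lambda>x. inv s \<otimes> x" and j = "\<lambda>x. s \<otimes> x"])
    (use assms in \<open>auto simp: m_assoc[symmetric]\<close>)

section \<open>Monomials as exponent vectors and the action of permutations\<close>

lemma lookup_sum_single:
  assumes "finite S"
  shows "Poly_Mapping.lookup (\<Sum>e\<in>S. Poly_Mapping.single e (k e)) e = (if e \<in> S then k e else 0)"
  using assms by (simp add: lookup_sum lookup_single when_def)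

lemma sum_single_lookup:
  "(\<Sum>e\<in>Poly_Mapping.keys M. Poly_Mapping.single e (Poly_Mapping.lookup M e)) = M"
  by (rule poly_mapping_eqI) (simp add: lookup_sum_single in_keys_iff)

lemma lookup_sqfree_part:
  "Poly_Mapping.lookup (sqfree_part M) e = (if Poly_Mapping.lookup M e = 0 then 0 else 1)"
  by (simp add: sqfree_part_def lookup_sum_single in_keys_iff)

text \<open>\<open>act\<close> pushes exponents forward along \<open>\<rho>\<close>; for a bijection
  this is pulling back along the inverse, so identities about the action can be checked exponent by
  exponent.\<close>

lemma lookup_act:
  assumes "bij \<rho>"
  shows "Poly_Mapping.lookup (act \<rho> M) e = Poly_Mapping.lookup M (inv' \<rho> ` e)"
proof -
  have "\<rho> ` d = e \<longleftrightarrow> d = inv' \<rho> ` e" for d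
    using assms by (auto simp: image_image bij_is_inj bij_is_surj surj_f_inv_f)
  then show ?thesis
    by (simp add: act_def lookup_sum lookup_single when_def in_keys_iff)
qed

lemma act_add:
  assumes "bij \<rho>"
  shows "act \<rho> (M + N) = act \<rho> M + act \<rho> N"
  by (rule poly_mapping_eqI) (simp add: lookup_act assms lookup_add)

lemma act_compose:
  assumes "bij \<rho>" "bij \<sigma>"
  shows "act (\<rho> \<circ> \<sigma>) M = act \<rho> (act \<sigma> M)"
  by (rule poly_mapping_eqI) (simp add: lookup_act assms bij_comp o_inv_distrib image_comp)

lemma act_id: "act id M = M"
  by (rule poly_mapping_eqI) (simp add: lookup_act)

lemma act_sqfree_part:
  assumes "bij \<rho>"
  shows "act \<rho> (sqfree_part M) = sqfree_part (act \<rho> M)"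
  by (rule poly_mapping_eqI) (simp add: lookup_act assms lookup_sqfree_part)

lemma bij_sym_group: "\<rho> \<in> carrier (sym_group n) \<Longrightarrow> bij \<rho>"
  by (simp add: sym_group_carrier permutes_bij)

lemma finite_sym_group: "finite (carrier (sym_group n))"
  by (simp add: sym_group_def finite_permutations)

text \<open>Elements of \<open>sym_group n\<close> fix all numbers outside \<open>{1..n}\<close>,
  hence are bijections of all naturals and act on all monomials. Acting on \<open>UNIV\<close> keeps
  membership conditions out of the orbit and stabilizer arguments.\<close>

lemma group_action_act: "group_action (sym_group n) UNIV act"
proof -
  have bij_act: "bij (act \<rho>)" if "bij \<rho>" for \<rho>
    by (rule o_bij[where g = "act (inv' \<rho>)"])
      (use that in \<open>auto simp: fun_eq_iff act_compose[symmetric] bij_imp_bij_inv act_id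
        bij_is_inj bij_is_surj surj_iff[THEN iffD1]\<close>)
  have "act \<in> hom (sym_group n) (BijGroup UNIV)"
    by (rule homI)
      (auto simp: BijGroup_def Bij_def bij_act bij_sym_group sym_group_mult compose_def
        act_compose fun_eq_iff)
  then show ?thesis
    by (simp add: group_action_def group_hom_def group_hom_axioms_def sym_group_is_group
        group_BijGroup)
qed

section \<open>Closure properties of the monomials in the given variables\<close>

lemma edges_image:
  assumes "\<rho> permutes {1..n}" "e \<in> edges n"
  shows "\<rho> ` e \<in> edges n"
proof -
  obtain i j where ij: "e = {i, j}" "1 \<le> i" "i < j" "j \<le> n"
    using assms(2) by (auto simp: edges_def)
  have "\<rho> i \<in> {1..n}" "\<rho> j \<in> {1..n}" "\<rho> i \<noteq> \<rho> j"
    using ij permutes_in_image[OF assms(1)] permutes_inj[OF assms(1)] by (auto dest: injD)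
  \<comment> \<open>An edge is recorded with its smaller endpoint first, and \<open>\<rho>\<close>
    may reverse the order of the endpoints.\<close>
  then show ?thesis
    unfolding edges_def ij(1)
    by (cases "\<rho> i < \<rho> j") (auto, metis doubleton_eq_iff linorder_neqE_nat)
qed

lemma act_in_monomials:
  assumes "M \<in> monomials n" "\<rho> \<in> carrier (sym_group n)"
  shows "act \<rho> M \<in> monomials n"
proof -
  have "Poly_Mapping.keys (act \<rho> M) \<subseteq> (\<lambda>e. \<rho> ` e) ` Poly_Mapping.keys M"
    unfolding act_def by (rule order_trans[OF keys_sum]) auto
  then show ?thesis
    using assms edges_image unfolding monomials_def sym_group_carrier by blast
qed

lemma zero_in_monomials: "0 \<in> monomials n"
  by (simp add: monomials_def)

lemma add_in_monomials: "M \<in> monomials n \<Longrightarrow> N \<in> monomials n \<Longrightarrow> M + N \<in> monomials n"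
  using keys_add[of M N] by (auto simp: monomials_def)

lemma single_in_monomials: "e \<in> edges n \<Longrightarrow> Poly_Mapping.single e k \<in> monomials n"
  by (auto simp: monomials_def)

lemma sum_in_monomials:
  "(\<And>i. i \<in> S \<Longrightarrow> f i \<in> monomials n) \<Longrightarrow> sum f S \<in> monomials n"
  by (induction S rule: infinite_finite_induct) (auto simp: zero_in_monomials add_in_monomials)

lemma sqfree_part_in_monomials: "M \<in> monomials n \<Longrightarrow> sqfree_part M \<in> monomials n"
  unfolding sqfree_part_def
  by (rule sum_in_monomials, rule single_in_monomials) (auto simp: monomials_def)

section \<open>The polynomial ring and its quotient \<open>R_n\<close>\<close>

lemma poly_ring_simps:
  "carrier (poly_ring n) = {p. Poly_Mapping.keys p \<subseteq> monomials n}"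
  "x \<otimes>\<^bsub>poly_ring n\<^esub> y = x * y" "x \<oplus>\<^bsub>poly_ring n\<^esub> y = x + y"
  "\<one>\<^bsub>poly_ring n\<^esub> = 1" "\<zero>\<^bsub>poly_ring n\<^esub> = 0"
  by (simp_all add: poly_ring_def)

lemma single_in_poly_ring: "M \<in> monomials n \<Longrightarrow> Poly_Mapping.single M c \<in> carrier (poly_ring n)"
  by (auto simp: poly_ring_simps)

text \<open>The equational laws are inherited from the type \<open>polynomial\<close>. Closure under
  products holds because each key of a product is a sum of keys of the factors.\<close>

lemma cring_poly_ring: "cring (poly_ring n)"
proof (rule cringI)
  show "abelian_group (poly_ring n)"
  proof (rule abelian_groupI)
    fix x y assume "x \<in> carrier (poly_ring n)" "y \<in> carrier (poly_ring n)"
    then show "x \<oplus>\<^bsub>poly_ring n\<^esub> y \<in> carrier (poly_ring n)"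
      using keys_add[of x y] by (auto simp: poly_ring_simps)
  next
    fix x assume "x \<in> carrier (poly_ring n)"
    then show "\<exists>y\<in>carrier (poly_ring n). y \<oplus>\<^bsub>poly_ring n\<^esub> x = \<zero>\<^bsub>poly_ring n\<^esub>"
      by (intro bexI[where x = "- x"]) (auto simp: poly_ring_simps)
  qed (auto simp: poly_ring_simps add_ac)
  show "comm_monoid (poly_ring n)"
  proof (rule comm_monoidI)
    fix x y assume "x \<in> carrier (poly_ring n)" "y \<in> carrier (poly_ring n)"
    then show "x \<otimes>\<^bsub>poly_ring n\<^esub> y \<in> carrier (poly_ring n)"
      using keys_mult[of x y] add_in_monomials by (fastforce simp: poly_ring_simps)
  qed (auto simp: poly_ring_simps mult_ac zero_in_monomials)
qed (auto simp: poly_ring_simps ring_distribs)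

interpretation P: cring "poly_ring n" for n
  by (rule cring_poly_ring)

lemma idem_generators_in_poly_ring:
  "{Poly_Mapping.single (Poly_Mapping.single e 2) 1
      - Poly_Mapping.single (Poly_Mapping.single e 1) 1 | e. e \<in> edges n} \<subseteq> carrier (poly_ring n)"
proof (clarsimp simp: poly_ring_simps)
  fix e :: "nat set" and M :: monomial
  assume "e \<in> edges n"
    and "M \<in> Poly_Mapping.keys (Poly_Mapping.single (Poly_Mapping.single e 2) (1::complex)
      - Poly_Mapping.single (Poly_Mapping.single e (Suc 0)) 1)"
  then show "M \<in> monomials n"
    using keys_diff single_in_monomials by fastforce
qed

lemma ideal_idem_ideal: "ideal (idem_ideal n) (poly_ring n)"
  unfolding idem_ideal_def by (rule P.genideal_ideal[OF idem_generators_in_poly_ring])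

lemma cring_Rring: "cring (Rring n)"
  unfolding Rring_def by (rule ideal.quotient_is_cring[OF ideal_idem_ideal cring_poly_ring])

interpretation R: cring "Rring n" for n
  by (rule cring_Rring)

lemma to_R_in_ring_hom: "to_R n \<in> ring_hom (poly_ring n) (Rring n)"
  using ideal.rcos_ring_hom[OF ideal_idem_ideal, of n] unfolding Rring_def to_R_def[abs_def] .

lemma to_R_closed: "p \<in> carrier (poly_ring n) \<Longrightarrow> to_R n p \<in> carrier (Rring n)"
  by (rule ring_hom_closed[OF to_R_in_ring_hom])

lemma to_R_mult:
  "p \<in> carrier (poly_ring n) \<Longrightarrow> q \<in> carrier (poly_ring n) \<Longrightarrow>
    to_R n (p * q) = to_R n p \<otimes>\<^bsub>Rring n\<^esub> to_R n q"
  using ring_hom_mult[OF to_R_in_ring_hom] by (simp add: poly_ring_simps)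

lemma sum_in_poly_ring:
  "(\<And>i. i \<in> S \<Longrightarrow> f i \<in> carrier (poly_ring n)) \<Longrightarrow> sum f S \<in> carrier (poly_ring n)"
proof (induction S rule: infinite_finite_induct)
  case (insert x F)
  then show ?case
    using P.add.m_closed[of "f x" n "sum f F"] by (simp add: poly_ring_simps)
qed (auto simp: poly_ring_simps)

text \<open>Giving the images as a separate family \<open>v\<close> lets one application both move
  \<open>to_R\<close> inside the sum and rewrite every term modulo the relations.\<close>

lemma to_R_sum:
  assumes "finite S" "\<And>i. i \<in> S \<Longrightarrow> f i \<in> carrier (poly_ring n)"
    and "\<And>i. i \<in> S \<Longrightarrow> to_R n (f i) = v i"
  shows "to_R n (sum f S) = (\<Oplus>\<^bsub>Rring n\<^esub> i\<in>S. v i)"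
  using assms
proof (induction S rule: finite_induct)
  case empty
  show ?case
    using ring_hom_zero[OF to_R_in_ring_hom P.ring_axioms R.ring_axioms]
    by (simp add: poly_ring_simps)
next
  case (insert x F)
  have "to_R n (f x + sum f F) = to_R n (f x) \<oplus>\<^bsub>Rring n\<^esub> to_R n (sum f F)"
    using ring_hom_add[OF to_R_in_ring_hom, of "f x" n "sum f F"] insert sum_in_poly_ring[of F f n]
    by (simp add: poly_ring_simps)
  moreover have "v i \<in> carrier (Rring n)" if "i \<in> insert x F" for i
    using insert.prems that to_R_closed by metis
  ultimately show ?case
    using insert by (simp add: R.finsum_insert Pi_def)
qed

section \<open>Reduction to square-free monomials modulo the relations\<close>

lemma to_R_single_add:
  assumes "M \<in> monomials n" "N \<in> monomials n"
  shows "to_R n (Poly_Mapping.single (M + N) 1) =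
    to_R n (Poly_Mapping.single M 1) \<otimes>\<^bsub>Rring n\<^esub> to_R n (Poly_Mapping.single N 1)"
  using to_R_mult[of "Poly_Mapping.single M 1" n "Poly_Mapping.single N 1"] assms
  by (simp add: single_in_poly_ring mult_single)

lemma to_R_square:
  assumes "e \<in> edges n"
  shows "to_R n (Poly_Mapping.single (Poly_Mapping.single e 2) 1) =
    to_R n (Poly_Mapping.single (Poly_Mapping.single e 1) 1)"
proof -
  let ?x = "Poly_Mapping.single (Poly_Mapping.single e 2) 1 :: polynomial"
  let ?y = "Poly_Mapping.single (Poly_Mapping.single e 1) 1 :: polynomial"
  have xy: "?x \<in> carrier (poly_ring n)" "?y \<in> carrier (poly_ring n)"
    using assms by (auto intro!: single_in_poly_ring single_in_monomials)
  \<comment> \<open>Equality of cosets is tested with the subtraction of the ring structure, the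
    generators are written with that of the type; the two have to be matched.\<close>
  have neg: "\<ominus>\<^bsub>poly_ring n\<^esub> ?y = - ?y"
    by (rule P.minus_equality) (use xy in \<open>auto simp: poly_ring_simps\<close>)
  have "?x - ?y \<in> idem_ideal n"
    unfolding idem_ideal_def
    using P.genideal_self[OF idem_generators_in_poly_ring] assms by blast
  then have "?x \<ominus>\<^bsub>poly_ring n\<^esub> ?y \<in> idem_ideal n"
    unfolding a_minus_def neg by (simp add: poly_ring_simps)
  then show ?thesis
    unfolding to_R_def
    using P.quotient_eq_iff_same_a_r_cos[OF ideal_idem_ideal xy] by simp
qed

text \<open>Each induction step absorbs one factor with \<open>to_R_square\<close>. The exponent is
  \<open>Suc k\<close> because the relation concerns positive exponents only; exponent 0 would give
  the monomial 1.\<close>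

lemma to_R_power:
  assumes e: "e \<in> edges n"
  shows "to_R n (Poly_Mapping.single (Poly_Mapping.single e (Suc k)) 1) =
    to_R n (Poly_Mapping.single (Poly_Mapping.single e 1) 1)"
proof (induction k)
  case (Suc k)
  have "Poly_Mapping.single e (Suc (Suc k)) = Poly_Mapping.single e 1 + Poly_Mapping.single e (Suc k)"
    by (simp flip: single_add)
  moreover have "Poly_Mapping.single e 2 = Poly_Mapping.single e 1 + Poly_Mapping.single e (1::nat)"
    by (simp flip: single_add add: numeral_2_eq_2)
  ultimately show ?case
    using Suc to_R_square[OF e] e
    by (simp add: to_R_single_add single_in_monomials)
qed simp

lemma to_R_sqfree_part:
  assumes "M \<in> monomials n"
  shows "to_R n (Poly_Mapping.single (sqfree_part M) 1) = to_R n (Poly_Mapping.single M 1)"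
proof -
  \<comment> \<open>The induction adds the variables of \<open>M\<close> one at a time, so it
    compares the parts of both monomials supported on a subset \<open>S\<close> of the
    variables.\<close>
  have "to_R n (Poly_Mapping.single (\<Sum>e\<in>S. Poly_Mapping.single e 1) 1) =
      to_R n (Poly_Mapping.single (\<Sum>e\<in>S. Poly_Mapping.single e (Poly_Mapping.lookup M e)) 1)"
    if "finite S" "S \<subseteq> Poly_Mapping.keys M" for S
    using that
  proof (induction S rule: finite_induct)
    case (insert e S)
    have edge: "d \<in> edges n" if "d \<in> insert e S" for d
      using that insert.prems assms by (auto simp: monomials_def)
    obtain k where "Poly_Mapping.lookup M e = Suc k"
      using insert.prems by (auto simp: in_keys_iff gr0_conv_Suc)
    then have "to_R n (Poly_Mapping.single (Poly_Mapping.single e (Poly_Mapping.lookup M e)) 1) =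
        to_R n (Poly_Mapping.single (Poly_Mapping.single e 1) 1)"
      using to_R_power[OF edge, of e k] by simp
    \<comment> \<open>For an arbitrary exponent function, this splits off the variable
      \<open>e\<close> on both sides: once with all exponents 1, once with the exponents of
      \<open>M\<close>.\<close>
    moreover have "to_R n (Poly_Mapping.single (\<Sum>d\<in>insert e S. Poly_Mapping.single d (k d)) 1) =
        to_R n (Poly_Mapping.single (Poly_Mapping.single e (k e)) 1) \<otimes>\<^bsub>Rring n\<^esub>
        to_R n (Poly_Mapping.single (\<Sum>d\<in>S. Poly_Mapping.single d (k d)) 1)" for k
      unfolding sum.insert[OF insert.hyps]
      by (intro to_R_single_add sum_in_monomials single_in_monomials edge) auto
    ultimately show ?case
      using insert.IH insert.prems by simp
  qed simp
  from this[of "Poly_Mapping.keys M"] show ?thesis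
    by (simp add: sqfree_part_def sum_single_lookup)
qed

section \<open>Orbit sums and symmetrizations in the polynomial ring\<close>

definition orbit_sum :: "nat \<Rightarrow> monomial \<Rightarrow> polynomial" where
  "orbit_sum n M = (\<Sum>N\<in>orbit (sym_group n) act M. Poly_Mapping.single N 1)"

text \<open>Every monomial of the orbit occurs here with multiplicity \<open>|Stab(M)|\<close>.
  Being a sum over the group, it can be reindexed by translations, which the orbit sum
  cannot.\<close>

definition sym_sum :: "nat \<Rightarrow> monomial \<Rightarrow> polynomial" where
  "sym_sum n M = (\<Sum>\<rho>\<in>carrier (sym_group n). Poly_Mapping.single (act \<rho> M) 1)"

lemma sym_sum_eq_orbit_sum: "sym_sum n M = of_nat (card (Stab n M)) * orbit_sum n M"
  unfolding sym_sum_def orbit_sum_def Stab_def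
  by (rule group_action.sum_over_group[OF group_action_act finite_sym_group UNIV_I])

text \<open>Acting on \<open>M\<close> first translates the summation variable on the right by
  \<open>\<sigma>\<close>, which only permutes the group.\<close>

lemma sym_sum_act:
  assumes "\<sigma> \<in> carrier (sym_group n)"
  shows "sym_sum n (act \<sigma> M) = sym_sum n M"
proof -
  interpret group "sym_group n" by (rule sym_group_is_group)
  have "sym_sum n (act \<sigma> M) =
      (\<Sum>\<rho>\<in>carrier (sym_group n). Poly_Mapping.single (act (\<rho> \<otimes>\<^bsub>sym_group n\<^esub> \<sigma>) M) 1)"
    unfolding sym_sum_def
    by (rule sum.cong) (use assms in \<open>auto simp: sym_group_mult act_compose bij_sym_group\<close>)
  then show ?thesis
    using sum_right_translate[OF assms, of "\<lambda>\<rho>. Poly_Mapping.single (act \<rho> M) 1"]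
    by (simp add: sym_sum_def)
qed

lemma sym_sum_mult:
  "sym_sum n A * sym_sum n B = (\<Sum>h\<in>carrier (sym_group n). sym_sum n (A + act h B))"
proof -
  interpret group "sym_group n" by (rule sym_group_is_group)
  let ?G = "carrier (sym_group n)"
  have "sym_sum n A * sym_sum n B =
      (\<Sum>\<rho>\<in>?G. \<Sum>\<sigma>\<in>?G. Poly_Mapping.single (act \<rho> A + act \<sigma> B) 1)"
    by (simp add: sym_sum_def sum_product mult_single)
  \<comment> \<open>For each fixed \<open>\<rho>\<close>, substitute
    \<open>\<sigma> = \<rho> h\<close>, so that \<open>\<rho>\<close> can be taken out of both
    factors.\<close>
  also have "\<dots> = (\<Sum>\<rho>\<in>?G. \<Sum>h\<in>?G. Poly_Mapping.single (act \<rho> A + act (\<rho> \<otimes>\<^bsub>sym_group n\<^esub> h) B) 1)"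
    by (intro sum.cong refl sum_left_translate[symmetric])
  also have "\<dots> = (\<Sum>\<rho>\<in>?G. \<Sum>h\<in>?G. Poly_Mapping.single (act \<rho> (A + act h B)) 1)"
    by (intro sum.cong refl) (simp add: sym_group_mult act_compose act_add bij_sym_group)
  also have "\<dots> = (\<Sum>h\<in>?G. sym_sum n (A + act h B))"
    unfolding sym_sum_def by (rule sum.swap)
  finally show ?thesis .
qed

lemma subgroup_Stab: "subgroup (Stab n M) (sym_group n)"
  unfolding Stab_def by (rule group_action.stabilizer_subgroup[OF group_action_act UNIV_I])

lemma card_subgroup_pos:
  assumes "subgroup H (sym_group n)"
  shows "card H > 0"
  using finite_subset[OF subgroup.subset[OF assms] finite_sym_group]
    subgroup.one_closed[OF assms] by (auto simp: card_gt_0_iff)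

text \<open>This makes the denominators of the formula nonzero.\<close>

lemma card_Stab_Int_conj_pos:
  assumes "g \<in> carrier (sym_group n)"
  shows "card (Stab n A \<inter> conj_set (sym_group n) g (Stab n B)) > 0"
proof -
  interpret group "sym_group n" by (rule sym_group_is_group)
  note sub = subgroup.subset[OF subgroup_Stab]
  \<comment> \<open>The identity is its own conjugate. The group inverse must stay in abstract form
    here, so that it cancels against \<open>g\<close> by the group laws.\<close>
  have "\<one>\<^bsub>sym_group n\<^esub> \<in> Stab n A \<inter> conj_set (sym_group n) g (Stab n B)"
    using assms subgroup.one_closed[OF subgroup_Stab] by (simp add: mem_conj_set[OF sub] del: sym_group_inv_equality)
  moreover have "finite (Stab n A \<inter> conj_set (sym_group n) g (Stab n B))"
    using finite_subset[OF sub finite_sym_group] by blast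
  ultimately show ?thesis
    by (auto simp: card_gt_0_iff)
qed

text \<open>The double coset formula holds already for polynomials, before any relation is imposed;
  the monomials \<open>A + act g B\<close> still carry their squares.\<close>

lemma orbit_sum_mult:
  assumes T: "double_coset_reps (sym_group n) (Stab n A) (Stab n B) T"
  shows "orbit_sum n A * orbit_sum n B =
    (\<Sum>g\<in>T. Poly_Mapping.single 0
        (1 / of_nat (card (Stab n A \<inter> conj_set (sym_group n) g (Stab n B))))
      * sym_sum n (A + act g B))"
proof -
  interpret group "sym_group n" by (rule sym_group_is_group)
  let ?G = "carrier (sym_group n)"
  let ?H = "Stab n A" and ?K = "Stab n B"
  let ?D = "\<lambda>g. double_coset (sym_group n) ?H g ?K"
  define d where "d g = card (?H \<inter> conj_set (sym_group n) g ?K)" for g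
  define m where "m = card ?H * card ?K"
  \<comment> \<open>Constant polynomials: division by a positive integer \<open>k\<close> is
    multiplication by \<open>C (1 / of_nat k)\<close>.\<close>
  define C :: "complex \<Rightarrow> polynomial" where "C = Poly_Mapping.single 0"
  have C_mult: "C (a * b) = C a * C b" for a b
    by (simp add: C_def mult_single)
  have C_one: "C 1 = 1"
    by (simp add: C_def)
  have C_of_nat: "of_nat k = C (of_nat k)" for k
    by (simp add: C_def)
  have TG: "T \<subseteq> ?G" and cover: "(\<Union>g\<in>T. ?D g) = ?G" and disj: "disjoint_family_on ?D T"
    using T by (auto simp: double_coset_reps_def)
  have finT: "finite T"
    using TG finite_sym_group by (rule finite_subset)
  have m_pos: "m > 0"
    using card_subgroup_pos[OF subgroup_Stab] by (simp add: m_def)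
  \<comment> \<open>Since \<open>y\<close> fixes \<open>B\<close> and \<open>x\<close> fixes
    \<open>A\<close>, the monomial for \<open>x g y\<close> is the image under \<open>x\<close> of
    the monomial for \<open>g\<close>, and both have the same symmetrization.\<close>
  have const: "sym_sum n (A + act (x \<otimes>\<^bsub>sym_group n\<^esub> g \<otimes>\<^bsub>sym_group n\<^esub> y) B) = sym_sum n (A + act g B)"
    if "x \<in> ?H" "y \<in> ?K" "g \<in> ?G" for x g y
  proof -
    have xy: "x \<in> ?G" "y \<in> ?G" "act x A = A" "act y B = B"
      using that by (auto simp: Stab_def stabilizer_def)
    then have "A + act (x \<otimes>\<^bsub>sym_group n\<^esub> g \<otimes>\<^bsub>sym_group n\<^esub> y) B = act x (A + act g B)"
      using that(3) by (simp add: sym_group_mult act_compose act_add bij_sym_group bij_comp)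
    then show ?thesis
      using sym_sum_act xy(1) by simp
  qed
  \<comment> \<open>Each element of the double coset comes from \<open>d g\<close> of the
    \<open>m\<close> pairs \<open>(x, y)\<close>, and all pairs contribute the same
    symmetrization.\<close>
  have coset: "C (of_nat (d g)) * (\<Sum>h\<in>?D g. sym_sum n (A + act h B)) =
      C (of_nat m) * sym_sum n (A + act g B)" if "g \<in> ?G" for g
  proof -
    have "of_nat (d g) * (\<Sum>h\<in>?D g. sym_sum n (A + act h B)) =
        (\<Sum>(x, y)\<in>?H \<times> ?K. sym_sum n (A + act (x \<otimes>\<^bsub>sym_group n\<^esub> g \<otimes>\<^bsub>sym_group n\<^esub> y) B))"
      unfolding d_def
      by (rule sum_over_double_coset[OF finite_sym_group subgroup_Stab subgroup_Stab that, symmetric])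
    also have "\<dots> = (\<Sum>p\<in>?H \<times> ?K. sym_sum n (A + act g B))"
      by (rule sum.cong) (use const that in auto)
    also have "\<dots> = of_nat m * sym_sum n (A + act g B)"
      by (simp add: m_def card_cartesian_product)
    finally show ?thesis
      by (simp only: C_of_nat)
  qed
  have coset': "(\<Sum>h\<in>?D g. sym_sum n (A + act h B)) =
      C (of_nat m) * (C (1 / of_nat (d g)) * sym_sum n (A + act g B))" if g: "g \<in> T" for g
  proof -
    have "d g > 0"
      unfolding d_def using g TG by (intro card_Stab_Int_conj_pos) auto
    then have "C (1 / of_nat (d g)) * C (of_nat (d g)) = 1"
      by (simp add: C_one flip: C_mult)
    then have "(\<Sum>h\<in>?D g. sym_sum n (A + act h B)) =
        C (1 / of_nat (d g)) * C (of_nat (d g)) * (\<Sum>h\<in>?D g. sym_sum n (A + act h B))"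
      by simp
    also have "\<dots> = C (1 / of_nat (d g)) * (C (of_nat m) * sym_sum n (A + act g B))"
      using g TG by (simp only: mult.assoc coset subsetD)
    finally show ?thesis
      by (simp only: mult.left_commute)
  qed
  have finD: "finite (?D g)" if "g \<in> T" for g
    using that cover finite_subset[OF _ finite_sym_group, of "?D g" n] by auto
  \<comment> \<open>The two stabilizer orders that make up \<open>m\<close> turn both orbit sums
    into symmetrizations; the same factor comes out of every double coset and is cancelled at the
    end.\<close>
  have "C (of_nat m) * (orbit_sum n A * orbit_sum n B) = sym_sum n A * sym_sum n B"
    unfolding sym_sum_eq_orbit_sum C_of_nat[symmetric] by (simp add: m_def mult_ac)
  also have "\<dots> = (\<Sum>h\<in>(\<Union>g\<in>T. ?D g). sym_sum n (A + act h B))"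
    by (simp only: sym_sum_mult cover)
  also have "\<dots> = (\<Sum>g\<in>T. \<Sum>h\<in>?D g. sym_sum n (A + act h B))"
    by (rule sum.UNION_disjoint) (use finT finD disj in \<open>auto simp: disjoint_family_on_def\<close>)
  also have "\<dots> = C (of_nat m) * (\<Sum>g\<in>T. C (1 / of_nat (d g)) * sym_sum n (A + act g B))"
    by (simp only: sum_distrib_left coset' cong: sum.cong)
  finally have eq: "C (of_nat m) * (orbit_sum n A * orbit_sum n B) =
      C (of_nat m) * (\<Sum>g\<in>T. C (1 / of_nat (d g)) * sym_sum n (A + act g B))" .
  have "C (1 / of_nat m) * C (of_nat m) = 1"
    using m_pos by (simp add: C_one flip: C_mult)
  with arg_cong[OF eq, of "\<lambda>p. C (1 / of_nat m) * p"] show ?thesis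
    unfolding C_def[symmetric] d_def[symmetric] by (simp flip: mult.assoc)
qed

section \<open>The formula in \<open>R_n\<close>\<close>

lemma Iorb_eq: "Iorb n M = to_R n (orbit_sum n M)"
  by (simp add: Iorb_def orbit_sum_def)

lemma orbit_sum_in_poly_ring: "M \<in> monomials n \<Longrightarrow> orbit_sum n M \<in> carrier (poly_ring n)"
  unfolding orbit_sum_def
  by (rule sum_in_poly_ring, rule single_in_poly_ring) (auto simp: orbit_def act_in_monomials)

lemma sym_sum_in_poly_ring: "M \<in> monomials n \<Longrightarrow> sym_sum n M \<in> carrier (poly_ring n)"
  unfolding sym_sum_def
  by (intro sum_in_poly_ring single_in_poly_ring act_in_monomials)

text \<open>Square-free parts commute with the action, so the two sums agree term by term modulo the
  relations. Orbit sums would not match in this way: the square-free part may have a larger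
  stabilizer and hence a smaller orbit.\<close>

lemma to_R_sym_sum_sqfree_part:
  assumes "M \<in> monomials n"
  shows "to_R n (sym_sum n (sqfree_part M)) = to_R n (sym_sum n M)"
proof -
  have closed: "Poly_Mapping.single (act \<rho> N) 1 \<in> carrier (poly_ring n)"
    if "\<rho> \<in> carrier (sym_group n)" "N \<in> monomials n" for \<rho> N
    using that by (intro single_in_poly_ring act_in_monomials)
  have "to_R n (Poly_Mapping.single (act \<rho> (sqfree_part M)) 1) =
      to_R n (Poly_Mapping.single (act \<rho> M) 1)" if "\<rho> \<in> carrier (sym_group n)" for \<rho>
    using that assms by (simp add: act_sqfree_part bij_sym_group to_R_sqfree_part act_in_monomials)
  with assms show ?thesis
    unfolding sym_sum_def
    by (simp add: to_R_sum[OF finite_sym_group closed, where v = "\<lambda>\<rho>. to_R n (Poly_Mapping.single (act \<rho> M) 1)"]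
        sqfree_part_in_monomials)
qed


theorem theorem1:
  fixes n :: nat and A B :: monomial and T :: "(nat \<Rightarrow> nat) set"
  assumes "n \<ge> 1"
    and "A \<in> monomials n" and "square_free A"
    and "B \<in> monomials n" and "square_free B"
    and "double_coset_reps (sym_group n) (Stab n A) (Stab n B) T"
  shows "Iorb n A \<otimes>\<^bsub>Rring n\<^esub> Iorb n B =
    (\<Oplus>\<^bsub>Rring n\<^esub> g\<in>T.
      scalar n (of_nat (card (Stab n (sqfree_part (A + act g B))))
          / of_nat (card (Stab n A \<inter> conj_set (sym_group n) g (Stab n B))))
        \<otimes>\<^bsub>Rring n\<^esub> Iorb n (sqfree_part (A + act g B)))"
proof -
  let ?d = "\<lambda>g. of_nat (card (Stab n A \<inter> conj_set (sym_group n) g (Stab n B))) :: complex"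
  let ?s = "\<lambda>g. of_nat (card (Stab n (sqfree_part (A + act g B)))) :: complex"
  have TG: "T \<subseteq> carrier (sym_group n)"
    using assms(6) by (simp add: double_coset_reps_def)
  have finT: "finite T"
    using TG finite_sym_group by (rule finite_subset)
  have mon: "A + act g B \<in> monomials n" if "g \<in> T" for g
    using that TG assms(2,4) by (auto intro: add_in_monomials act_in_monomials)
  have const: "Poly_Mapping.single 0 c \<in> carrier (poly_ring n)" for c
    by (rule single_in_poly_ring[OF zero_in_monomials])
  have term_closed:
    "Poly_Mapping.single 0 (1 / ?d g) * sym_sum n (A + act g B) \<in> carrier (poly_ring n)"
    if "g \<in> T" for g
    using P.m_closed[OF const sym_sum_in_poly_ring[OF mon[OF that]]] by (simp add: poly_ring_simps(2))
  have "to_R n (Poly_Mapping.single 0 (1 / ?d g) * sym_sum n (A + act g B)) =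
      scalar n (?s g / ?d g) \<otimes>\<^bsub>Rring n\<^esub> Iorb n (sqfree_part (A + act g B))" if "g \<in> T" for g
  proof -
    let ?M = "A + act g B"
    have "to_R n (Poly_Mapping.single 0 (1 / ?d g) * sym_sum n ?M) =
        to_R n (Poly_Mapping.single 0 (1 / ?d g) * sym_sum n (sqfree_part ?M))"
      using mon[OF that]
      by (simp add: to_R_mult const sym_sum_in_poly_ring sqfree_part_in_monomials
          to_R_sym_sum_sqfree_part)
    \<comment> \<open>Only now does the symmetrization become an orbit sum again, so the factor that
      appears is the order of the stabilizer of the square-free part: the numerator of the
      coefficient.\<close>
    also have "Poly_Mapping.single 0 (1 / ?d g) * sym_sum n (sqfree_part ?M) =
        Poly_Mapping.single 0 (?s g / ?d g) * orbit_sum n (sqfree_part ?M)"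
      by (simp add: sym_sum_eq_orbit_sum mult_single flip: single_of_nat mult.assoc)
    finally show ?thesis
      using mon[OF that]
      by (simp add: to_R_mult const orbit_sum_in_poly_ring sqfree_part_in_monomials
          scalar_def Iorb_eq)
  qed
  note to_R_term = this
  have "Iorb n A \<otimes>\<^bsub>Rring n\<^esub> Iorb n B = to_R n (orbit_sum n A * orbit_sum n B)"
    using assms(2,4) by (simp add: Iorb_eq to_R_mult orbit_sum_in_poly_ring)
  also have "\<dots> = to_R n (\<Sum>g\<in>T. Poly_Mapping.single 0 (1 / ?d g) * sym_sum n (A + act g B))"
    by (simp only: orbit_sum_mult[OF assms(6)])
  also have "\<dots> = (\<Oplus>\<^bsub>Rring n\<^esub> g\<in>T.
      scalar n (?s g / ?d g) \<otimes>\<^bsub>Rring n\<^esub> Iorb n (sqfree_part (A + act g B)))"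
    by (rule to_R_sum[OF finT term_closed to_R_term])
  finally show ?thesis .
qed

end
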